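(* Let $a,b,n$ be positive integers. Then the Tutte polynomial of the $(a,b)$-Catalan matroid satisfies $$T_{C_n^{a,b}}(x,y)=\sum_{\lambda\vdash n}\frac1{z_\lambda}\,T_{U_\lambda^{a,b}}(x,y),$$ where the sum is over all partitions $\lambda=(\lambda_1,\dots,\lambda_k)$ of $n$ and $T_{U_\lambda^{a,b}}(x,y)=\prod_{j=1}^k T_{U_{\lambda_j}^{a,b}}(x,y)$.
   Context: For $m\ge1$, $U_m^{a,b}=U_{mb,m(a+b)}$ is the uniform matroid of rank $mb$ on $m(a+b)$ elements. For $S\subseteq[N]$, the Schubert matroid $\mathrm{SM}_N(S)$ is the matroid on $[N]$ whose bases are the $T\subseteq[N]$ with $|T|=|S|$ such that for every $i$ the $i$-th smallest element of $T$ is at most the $i$-th smallest element of $S$. The $(a,b)$-Catalan matroid $C_n^{a,b}$ is $\mathrm{SM}_{n(a+b)}(S)$ where $S$ has indicator vector $(0^a,1^b,\dots,0^a,1^b)$ ($n$ blocks of $a$ zeros followed by $b$ ones). For a partition $\lambda$ of $n$ in which $i$ appears $\alpha_i$ times, $z_\lambda=\prod_i i^{\alpha_i}\alpha_i!$. The Tutte polynomial of a matroid $M$ on $E$ with rank function $\mathrm{rk}$ is $T_M(x,y)=\sum_{A\subseteq E}(x-1)^{\mathrm{rk}(E)-\mathrm{rk}(A)}(y-1)^{|A|-\mathrm{rk}(A)}$. *)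

theory Defs
  imports
    Complex_Main
    "HOL-Library.Multiset"
    "HOL-Computational_Algebra.Polynomial"
begin

section \<open>Matroids\<close>

text \<open>Matroids are given by a ground set and a family of bases; the record carries the data,
  the predicate \<open>matroid\<close> the axioms.\<close>

record 'a pre_matroid =
  ground :: "'a set"
  bases :: "'a set set"

definition matroid :: "'a pre_matroid \<Rightarrow> bool" where
  "matroid M \<longleftrightarrow>
     finite (ground M) \<and> bases M \<noteq> {} \<and> (\<forall>B\<in>bases M. B \<subseteq> ground M) \<and>
     (\<forall>B1\<in>bases M. \<forall>B2\<in>bases M. \<forall>x\<in>B1 - B2. \<exists>y\<in>B2 - B1. insert y (B1 - {x}) \<in> bases M)"

definition indep :: "'a pre_matroid \<Rightarrow> 'a set \<Rightarrow> bool" where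
  "indep M I \<longleftrightarrow> (\<exists>B\<in>bases M. I \<subseteq> B)"

definition rk :: "'a pre_matroid \<Rightarrow> 'a set \<Rightarrow> nat" where
  "rk M A = Max {card I | I. I \<subseteq> A \<and> indep M I}"


section \<open>Tutte polynomial\<close>

text \<open>\<open>\<rat>[x, y]\<close> is rendered as \<open>\<rat>[x][y]\<close>: the inner indeterminate is \<open>x\<close>, the outer one \<open>y\<close>.\<close>

definition var_x :: "rat poly poly" where
  "var_x = [:[:0, 1:]:]"

definition var_y :: "rat poly poly" where
  "var_y = [:0, 1:]"

text \<open>For a matroid, \<open>rk\<close> is monotone and bounded by the cardinality, so the natural-number
  subtractions in the exponents do not truncate.\<close>

definition tutte_poly :: "'a pre_matroid \<Rightarrow> rat poly poly" where
  "tutte_poly M =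
     (\<Sum>A\<in>Pow (ground M).
        (var_x - 1) ^ (rk M (ground M) - rk M A) * (var_y - 1) ^ (card A - rk M A))"


section \<open>Uniform, Schubert and Catalan matroids\<close>

definition uniform_matroid :: "nat \<Rightarrow> nat \<Rightarrow> nat pre_matroid" where
  "uniform_matroid r N = \<lparr>ground = {1..N}, bases = {B. B \<subseteq> {1..N} \<and> card B = r}\<rparr>"

definition U_matroid :: "nat \<Rightarrow> nat \<Rightarrow> nat \<Rightarrow> nat pre_matroid" where
  "U_matroid a b m = uniform_matroid (m * b) (m * (a + b))"

definition schubert_matroid :: "nat \<Rightarrow> nat set \<Rightarrow> nat pre_matroid" where
  "schubert_matroid N S =
     \<lparr>ground = {1..N},
      bases = {T. T \<subseteq> {1..N} \<and> card T = card S \<and>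
                  (\<forall>i<card S. sorted_list_of_set T ! i \<le> sorted_list_of_set S ! i)}\<rparr>"

text \<open>The entry at list index \<open>i\<close> of an indicator vector is the coordinate \<open>i + 1\<close>.\<close>

definition set_of_indicator :: "bool list \<Rightarrow> nat set" where
  "set_of_indicator w = {Suc i | i. i < length w \<and> w ! i}"

definition catalan_matroid :: "nat \<Rightarrow> nat \<Rightarrow> nat \<Rightarrow> nat pre_matroid" where
  "catalan_matroid a b n =
     schubert_matroid (n * (a + b))
       (set_of_indicator (concat (replicate n (replicate a False @ replicate b True))))"


section \<open>Integer partitions\<close>

definition partitions :: "nat \<Rightarrow> nat multiset set" where
  "partitions n = {l. 0 \<notin># l \<and> sum_mset l = n}"

definition z_part :: "nat multiset \<Rightarrow> nat" where
  "z_part l = (\<Prod>i\<in>set_mset l. i ^ count l i * fact (count l i))"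


section \<open>Well-definedness\<close>

lemma finite_partitions: "finite (partitions n)"
proof -
  have size_le: "size l \<le> sum_mset l" if "0 \<notin># l" for l :: "nat multiset"
    using that by (induction l) auto
  have "partitions n \<subseteq> mset ` {xs. set xs \<subseteq> {0..n} \<and> length xs \<le> n}"
  proof
    fix l assume l: "l \<in> partitions n"
    obtain xs where xs: "mset xs = l" using ex_mset by blast
    have "length xs \<le> n" using l size_le[of l] xs
      by (auto simp: partitions_def simp flip: size_mset)
    moreover have "x \<le> n" if "x \<in> set xs" for x
      using l that xs member_le_sum_list[of x xs]
      by (auto simp: partitions_def sum_mset_sum_list)
    ultimately show "l \<in> mset ` {xs. set xs \<subseteq> {0..n} \<and> length xs \<le> n}"
      using xs by auto
  qed
  then show ?thesis
    using finite_lists_length_le[of "{0..n}" n] by (meson finite_atLeastAtMost finite_imageI finite_subset)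
qed

lemma matroid_uniform:
  assumes "r \<le> N"
  shows "matroid (uniform_matroid r N)"
proof -
  have "{1..r} \<subseteq> {1..N} \<and> card {1..r} = r" using assms by auto
  then have ne: "\<exists>B. B \<subseteq> {1..N} \<and> card B = r" by blast
  have "\<exists>y\<in>B2 - B1. insert y (B1 - {x}) \<subseteq> {1..N} \<and> card (insert y (B1 - {x})) = r"
    if B: "B1 \<subseteq> {1..N}" "card B1 = r" "B2 \<subseteq> {1..N}" "card B2 = r" and x: "x \<in> B1 - B2" for B1 B2 x
  proof -
    have fin: "finite B1" "finite B2" using B finite_subset by blast+
    have "\<not> B2 \<subseteq> B1" using card_subset_eq[OF fin(1)] B x by auto
    then obtain y where y: "y \<in> B2 - B1" by blast
    moreover have "card (insert y (B1 - {x})) = r"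
      using y x fin B by (metis Diff_iff card.insert card_Suc_Diff1 finite_Diff)
    ultimately show ?thesis using B by blast
  qed
  with ne show ?thesis by (auto simp: matroid_def uniform_matroid_def)
qed

lemma nth_sorted_list_of_set_le_iff:
  fixes S :: "nat set"
  assumes "finite S" "i < card S"
  shows "sorted_list_of_set S ! i \<le> k \<longleftrightarrow> i < card (S \<inter> {..k})"
proof -
  let ?xs = "sorted_list_of_set S"
  have len: "length ?xs = card S" by simp
  have mono: "?xs ! p < ?xs ! q" if "p < q" "q < card S" for p q
    using that sorted_wrt_nth_less[OF strict_sorted_list_of_set, of p q S] len by auto
  let ?J = "{j. j < card S \<and> ?xs ! j \<le> k}"
  have "S \<inter> {..k} = set ?xs \<inter> {..k}" using assms(1) by simp
  also have "\<dots> = (!) ?xs ` ?J" unfolding set_conv_nth len by blast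
  finally have "S \<inter> {..k} = (!) ?xs ` ?J" .
  moreover have "inj_on ((!) ?xs) ?J"
    by (auto intro!: inj_onI simp: nth_eq_iff_index_eq)
  ultimately have card: "card (S \<inter> {..k}) = card ?J" by (simp add: card_image)
  show ?thesis
  proof (cases "?xs ! i \<le> k")
    case True
    have "j \<in> ?J" if "j \<le> i" for j
      using True mono[of j i] that assms(2) by (cases "j = i") auto
    then have "{..i} \<subseteq> ?J" by blast
    then have "card {..i} \<le> card ?J" by (intro card_mono) auto
    then show ?thesis using True card by simp
  next
    case False
    have "j < i" if "j \<in> ?J" for j
      using False mono[of i j] that by (cases j i rule: linorder_cases) auto
    then have "?J \<subseteq> {..<i}" by blast
    then have "card ?J \<le> card {..<i}" by (intro card_mono) auto
    then show ?thesis using False card by simp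
  qed
qed

lemma sorted_list_of_set_le_iff_card:
  fixes S T :: "nat set"
  assumes "finite S" "finite T" "card T = card S"
  shows "(\<forall>i<card S. sorted_list_of_set T ! i \<le> sorted_list_of_set S ! i) \<longleftrightarrow>
         (\<forall>k. card (S \<inter> {..k}) \<le> card (T \<inter> {..k}))"
proof
  assume L: "\<forall>i<card S. sorted_list_of_set T ! i \<le> sorted_list_of_set S ! i"
  show "\<forall>k. card (S \<inter> {..k}) \<le> card (T \<inter> {..k})"
  proof
    fix k
    show "card (S \<inter> {..k}) \<le> card (T \<inter> {..k})"
    proof (rule ccontr)
      assume *: "\<not> ?thesis"
      define i where "i = card (T \<inter> {..k})"
      have i: "i < card (S \<inter> {..k})" using * by (simp add: i_def)
      also have "\<dots> \<le> card S" using assms(1) by (intro card_mono) auto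
      finally have iS: "i < card S" .
      have "sorted_list_of_set S ! i \<le> k"
        using i nth_sorted_list_of_set_le_iff[OF assms(1) iS] by blast
      then have "sorted_list_of_set T ! i \<le> k" using L iS order.trans by blast
      then have "i < card (T \<inter> {..k})"
        using nth_sorted_list_of_set_le_iff[OF assms(2)] iS assms(3) by metis
      then show False by (simp add: i_def)
    qed
  qed
next
  assume R: "\<forall>k. card (S \<inter> {..k}) \<le> card (T \<inter> {..k})"
  show "\<forall>i<card S. sorted_list_of_set T ! i \<le> sorted_list_of_set S ! i"
  proof (intro allI impI)
    fix i assume i: "i < card S"
    let ?k = "sorted_list_of_set S ! i"
    have "i < card (S \<inter> {..?k})" using nth_sorted_list_of_set_le_iff[OF assms(1) i] by blast
    then have "i < card (T \<inter> {..?k})" using R order.strict_trans2 by blast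
    then show "sorted_list_of_set T ! i \<le> ?k"
      using nth_sorted_list_of_set_le_iff[OF assms(2)] i assms(3) by metis
  qed
qed

lemma matroid_schubert:
  assumes "S \<subseteq> {1..N}"
  shows "matroid (schubert_matroid N S)"
proof -
  have finS: "finite S" using assms finite_subset by blast
  have bases_iff: "T \<in> bases (schubert_matroid N S) \<longleftrightarrow>
      T \<subseteq> {1..N} \<and> card T = card S \<and> (\<forall>k. card (S \<inter> {..k}) \<le> card (T \<inter> {..k}))" for T
  proof (cases "T \<subseteq> {1..N} \<and> card T = card S")
    case True
    then have "finite T" using finite_subset by blast
    then show ?thesis
      using True sorted_list_of_set_le_iff_card[OF finS, of T] by (simp add: schubert_matroid_def)
  qed (auto simp: schubert_matroid_def)
  have "\<exists>y\<in>B2 - B1. insert y (B1 - {x}) \<in> bases (schubert_matroid N S)"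
    if B: "B1 \<in> bases (schubert_matroid N S)" "B2 \<in> bases (schubert_matroid N S)"
      and x: "x \<in> B1 - B2" for B1 B2 x
  proof -
    have B1: "B1 \<subseteq> {1..N}" "card B1 = card S" "\<And>k. card (S \<inter> {..k}) \<le> card (B1 \<inter> {..k})"
      and B2: "B2 \<subseteq> {1..N}" "card B2 = card S" "\<And>k. card (S \<inter> {..k}) \<le> card (B2 \<inter> {..k})"
      using B by (auto simp: bases_iff)
    have fin: "finite B1" "finite B2" using B1 B2 finite_subset by blast+
    have "\<not> B2 \<subseteq> B1" using card_subset_eq[OF fin(1)] B1 B2 x by auto
    then have ne: "B2 - B1 \<noteq> {}" by blast
    define y where "y = Min (B2 - B1)"
    have y: "y \<in> B2 - B1" using Min_in[of "B2 - B1"] ne fin by (simp add: y_def)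
    have y_le: "y \<le> z" if "z \<in> B2 - B1" for z using that fin by (simp add: y_def)
    let ?B = "insert y (B1 - {x})"
    have "card ?B = card S"
      using y x fin B1(2) by (metis Diff_iff card.insert card_Suc_Diff1 finite_Diff)
    moreover have "card (S \<inter> {..k}) \<le> card (?B \<inter> {..k})" for k
    proof (cases "k < y")
      case True
      then have "B2 \<inter> {..k} \<subseteq> ?B \<inter> {..k}" using y_le x by fastforce
      then have "card (B2 \<inter> {..k}) \<le> card (?B \<inter> {..k})" using fin by (intro card_mono) auto
      then show ?thesis using B2(3) order.trans by blast
    next
      case False
      then have eq: "?B \<inter> {..k} = insert y (B1 \<inter> {..k} - {x})" by auto
      have "card (?B \<inter> {..k}) = Suc (card (B1 \<inter> {..k} - {x}))"
        unfolding eq using y fin by (subst card.insert) auto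
      moreover have "card (B1 \<inter> {..k}) \<le> Suc (card (B1 \<inter> {..k} - {x}))"
        by (cases "x \<in> B1 \<inter> {..k}") (simp_all add: card_Diff_singleton_if)
      ultimately show ?thesis using B1(3)[of k] by linarith
    qed
    ultimately show ?thesis using y B1 B2 unfolding bases_iff by blast
  qed
  moreover have "S \<in> bases (schubert_matroid N S)" using assms bases_iff by blast
  moreover have "B \<subseteq> ground (schubert_matroid N S)" if "B \<in> bases (schubert_matroid N S)" for B
    using that by (simp add: schubert_matroid_def)
  moreover have "finite (ground (schubert_matroid N S))" by (simp add: schubert_matroid_def)
  ultimately show ?thesis unfolding matroid_def by blast
qed

lemma matroid_U: "matroid (U_matroid a b m)"
  unfolding U_matroid_def by (intro matroid_uniform) simp

lemma matroid_catalan: "matroid (catalan_matroid a b n)"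
proof -
  let ?w = "concat (replicate n (replicate a False @ replicate b True))"
  have "length ?w = n * (a + b)" by (induction n) auto
  then have "set_of_indicator ?w \<subseteq> {1..n * (a + b)}"
    by (auto simp: set_of_indicator_def)
  then show ?thesis unfolding catalan_matroid_def by (rule matroid_schubert)
qed

end

(* A subset A of the ground set is a word of n blocks, hence an integer walk whose i-th step is
   |A \<inter> block i| - b.  In the Catalan matroid the corank of A is the depth of the walk (minus its
   minimum) and the nullity is its final height above that minimum; in the uniform matroid they are
   the negative and the positive part of the endpoint.  The theorem is thus Spitzer's identity.
   It is proved by Wiener-Hopf factorization: cutting each walk at its first minimum writes the
   generating function as D(u) * P(v), which at (u, v) = (1/q, q) is the geometric series
   1 / (1 - w(q) t).  Taking logarithmic derivatives in t and separating negative from nonnegative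
   powers of q identifies those of D and P.  Both sides of the theorem then solve t F' = G F with
   the same G.  Bivariate polynomials are compared through their values at rational points. *)
theory Submission
  imports Defs "HOL-Computational_Algebra.Formal_Power_Series"
begin

section \<open>Logarithmic derivatives of power series\<close>

text \<open>This is t f'/f = d with the denominator cleared, so it makes sense over any commutative
  ring, in particular for series with polynomial coefficients.\<close>

definition has_log_deriv :: "'a::comm_ring_1 fps \<Rightarrow> 'a fps \<Rightarrow> bool" where
  "has_log_deriv f d \<longleftrightarrow> fps_X * fps_deriv f = d * f"

lemma has_log_deriv_mult:
  assumes "has_log_deriv f d" "has_log_deriv g e"
  shows "has_log_deriv (f * g) (d + e)"
proof -
  have "fps_X * fps_deriv (f * g) = f * (fps_X * fps_deriv g) + (fps_X * fps_deriv f) * g"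
    by (simp add: algebra_simps)
  then show ?thesis using assms unfolding has_log_deriv_def by (simp add: algebra_simps)
qed

lemma has_log_deriv_unique:
  fixes f d e :: "'a::idom fps"
  assumes "has_log_deriv f d" "has_log_deriv f e" "f \<noteq> 0"
  shows "d = e"
  using assms unfolding has_log_deriv_def by simp

text \<open>A series with constant term 1 is invertible even when the coefficients do not form a
  field.\<close>

lemma has_log_deriv_exists:
  fixes f :: "'a::comm_ring_1 fps"
  assumes "fps_nth f 0 = 1"
  obtains d where "has_log_deriv f d"
proof -
  have "f * fps_right_inverse f 1 = 1" using assms by (intro fps_right_inverse) simp
  then have "fps_X * fps_deriv f * fps_right_inverse f 1 * f = fps_X * fps_deriv f"
    by (metis mult.assoc mult.commute mult.right_neutral)
  then have "has_log_deriv f (fps_X * fps_deriv f * fps_right_inverse f 1)"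
    unfolding has_log_deriv_def by simp
  then show ?thesis using that by blast
qed

lemma has_log_deriv_nth:
  assumes "has_log_deriv f d"
  shows "of_nat n * fps_nth f n = (\<Sum>i=0..n. fps_nth d i * fps_nth f (n - i))"
proof -
  have "fps_nth (fps_X * fps_deriv f) n = of_nat n * fps_nth f n"
    by (cases n) (simp_all del: of_nat_Suc)
  then show ?thesis using assms unfolding has_log_deriv_def by (simp add: fps_mult_nth)
qed

lemma has_log_derivI:
  assumes "\<And>n. of_nat n * fps_nth f n = (\<Sum>i=0..n. fps_nth d i * fps_nth f (n - i))"
  shows "has_log_deriv f d"
proof -
  have "fps_nth (fps_X * fps_deriv f) n = of_nat n * fps_nth f n" for n
    by (cases n) (simp_all del: of_nat_Suc)
  then show ?thesis using assms unfolding has_log_deriv_def by (simp add: fps_eq_iff fps_mult_nth)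
qed

text \<open>Since d has no constant term, the convolution recursion expresses n times the n-th
  coefficient through earlier ones; characteristic 0 allows division by n.\<close>

lemma has_log_deriv_eqI:
  fixes f g :: "'a::field_char_0 fps"
  assumes f: "has_log_deriv f d" and g: "has_log_deriv g d"
    and d0: "fps_nth d 0 = 0" and eq0: "fps_nth f 0 = fps_nth g 0"
  shows "f = g"
proof (rule fps_ext)
  fix n
  show "fps_nth f n = fps_nth g n"
  proof (induction n rule: less_induct)
    case (less n)
    show ?case
    proof (cases "n = 0")
      case False
      have "fps_nth d i * fps_nth f (n - i) = fps_nth d i * fps_nth g (n - i)" for i
        using less[of "n - i"] d0 False by (cases "i = 0") auto
      then have "of_nat n * fps_nth f n = of_nat n * fps_nth g n"
        by (simp only: has_log_deriv_nth[OF f] has_log_deriv_nth[OF g])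
      then show ?thesis using False by simp
    qed (use eq0 in simp)
  qed
qed

section \<open>Specialization and separation of polynomial coefficients\<close>

definition fps_eval :: "'a::comm_ring_1 \<Rightarrow> 'a poly fps \<Rightarrow> 'a fps" where
  "fps_eval c f = Abs_fps (\<lambda>n. poly (fps_nth f n) c)"

lemma fps_nth_eval [simp]: "fps_nth (fps_eval c f) n = poly (fps_nth f n) c"
  by (simp add: fps_eval_def)

lemma has_log_deriv_eval:
  assumes "has_log_deriv f d"
  shows "has_log_deriv (fps_eval c f) (fps_eval c d)"
proof (rule has_log_derivI)
  fix n
  show "of_nat n * fps_nth (fps_eval c f) n =
      (\<Sum>i=0..n. fps_nth (fps_eval c d) i * fps_nth (fps_eval c f) (n - i))"
    using arg_cong[OF has_log_deriv_nth[OF assms, of n], of "\<lambda>p. poly p c"]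
    by (simp add: poly_sum)
qed

text \<open>The two series are 1/(1 - w t) and w t/(1 - w t).\<close>

lemma has_log_deriv_geometric:
  "has_log_deriv (Abs_fps (\<lambda>n. w ^ n)) (Abs_fps (\<lambda>n. if n = 0 then 0 else w ^ n))"
proof (rule has_log_derivI)
  fix n
  have "(\<Sum>i=0..n. (if i = 0 then 0 else w ^ i) * w ^ (n - i)) = (\<Sum>i\<in>{1..n}. w ^ n)"
    by (rule sum.mono_neutral_cong_right) (auto simp flip: power_add)
  then show "of_nat n * fps_nth (Abs_fps (\<lambda>n. w ^ n)) n =
      (\<Sum>i=0..n. fps_nth (Abs_fps (\<lambda>n. if n = 0 then 0 else w ^ n)) i *
        fps_nth (Abs_fps (\<lambda>n. w ^ n)) (n - i))"
    by simp
qed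

text \<open>The Laurent polynomial \<open>A(1/q) - B(q)\<close> vanishes, and its two parts do not overlap.\<close>

lemma poly_inverse_eq_imp_0:
  fixes A B :: "'a::field_char_0 poly"
  assumes eq: "\<And>q. q \<noteq> 0 \<Longrightarrow> poly A (1 / q) = poly B q" and A0: "poly A 0 = 0"
  shows "A = 0 \<and> B = 0"
proof -
  \<comment> \<open>The power q^(degree A) clears the negative exponents; the additional factor q
    makes the equation hold at q = 0, where the hypothesis is silent.\<close>
  have "poly ([:0, 1:] * reflect_poly A) q = poly ([:0, 1:] * (monom 1 (degree A) * B)) q" for q
    using eq[of q] by (cases "q = 0") (simp_all add: poly_reflect_poly_nz poly_monom divide_inverse)
  then have "[:0, 1:] * reflect_poly A = [:0, 1:] * (monom 1 (degree A) * B)"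
    using poly_eq_poly_eq_iff by blast
  then have R: "reflect_poly A = monom 1 (degree A) * B"
    by simp
  have "coeff B i = 0" for i
  proof -
    \<comment> \<open>The reflected polynomial has no coefficients beyond \<open>degree A\<close>,
      and its coefficient at \<open>degree A\<close> is A(0) = 0.\<close>
    have "coeff B i = coeff (reflect_poly A) (degree A + i)"
      by (simp add: R coeff_monom_mult)
    also have "\<dots> = 0" using A0 by (cases i) (simp_all add: coeff_reflect_poly poly_0_coeff_0)
    finally show ?thesis .
  qed
  then have "B = 0" by (simp add: poly_eq_iff)
  then show ?thesis using R by simp
qed


section \<open>Walks and Spitzer's identity\<close>

text \<open>The depth is \<open>- min\<^sub>j (x\<^sub>1 + \<dots> + x\<^sub>j)\<close>, over \<open>j = 0, \<dots>, length xs\<close>.\<close>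

fun depth :: "int list \<Rightarrow> int" where
  "depth [] = 0"
| "depth (x # xs) = max 0 (depth xs - x)"

text \<open>The endpoint lies strictly below all earlier points of the walk.\<close>

fun ends_at_strict_min :: "int list \<Rightarrow> bool" where
  "ends_at_strict_min [] \<longleftrightarrow> True"
| "ends_at_strict_min (x # xs) \<longleftrightarrow> x + sum_list xs < 0 \<and> ends_at_strict_min xs"

lemma depth_nonneg: "0 \<le> depth xs"
  by (cases xs) auto

text \<open>Together with \<open>depth_attained\<close> this identifies the recursion with the
  intended maximum over prefixes.\<close>

lemma depth_ge: "- sum_list (take j xs) \<le> depth xs"
proof (induction xs arbitrary: j)
  case (Cons x xs)
  show ?case
  proof (cases j)
    case (Suc i)
    then show ?thesis using Cons[of i] by simp
  qed simp
qed simp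

lemma depth_attained: "\<exists>j\<le>length xs. depth xs = - sum_list (take j xs)"
proof (induction xs)
  case (Cons x xs)
  then obtain j where j: "j \<le> length xs" "depth xs = - sum_list (take j xs)" by blast
  show ?case
  proof (cases "depth xs - x \<le> 0")
    case True
    then show ?thesis by (intro exI[of _ 0]) simp
  next
    case False
    then show ?thesis using j by (intro exI[of _ "Suc j"]) simp
  qed
qed simp

lemma sum_add_depth_nonneg: "0 \<le> sum_list xs + depth xs"
  using depth_ge[of "length xs" xs] by simp

lemma sum_neg_of_strict_min: "ends_at_strict_min xs \<Longrightarrow> xs \<noteq> [] \<Longrightarrow> sum_list xs < 0"
  by (cases xs) auto

text \<open>The minimum sits at the junction: the first part ends below all its earlier points, and
  a second part of depth 0 never goes below its start.\<close>

lemma depth_append_strict_min: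
  assumes "ends_at_strict_min xs" "depth ys = 0"
  shows "depth (xs @ ys) = - sum_list xs"
  using assms by (induction xs) auto

text \<open>The cut is the first visit to the minimum: strictness on the left excludes earlier
  visits, while later returns are allowed. When a step is prepended, either the new start is minimal
  and the cut is 0, or the old cut shifts by one.\<close>

lemma first_min_ex1:
  "\<exists>!k. k \<le> length xs \<and> ends_at_strict_min (take k xs) \<and> depth (drop k xs) = 0"
proof (induction xs)
  case (Cons x xs)
  let ?P = "\<lambda>xs k. k \<le> length xs \<and> ends_at_strict_min (take k xs) \<and> depth (drop k xs) = 0"
  have dep: "depth xs = - sum_list (take k xs)" if "?P xs k" for k
    using depth_append_strict_min[of "take k xs" "drop k xs"] that by simp
  obtain k where k: "?P xs k" "\<And>i. ?P xs i \<Longrightarrow> i = k" using Cons by blast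
  show ?case
  proof (cases "depth xs - x \<le> 0")
    case True
    have "i = 0" if P: "?P (x # xs) i" for i
    proof (cases i)
      case (Suc j)
      then have "?P xs j" "x + sum_list (take j xs) < 0" using P by auto
      then show ?thesis using dep[of j] True by simp
    qed
    then show ?thesis using True by (intro ex1I[of _ 0]) auto
  next
    case False
    have "i = Suc k" if P: "?P (x # xs) i" for i
    proof (cases i)
      case 0
      then show ?thesis using P False by simp
    next
      case (Suc j)
      then show ?thesis using P k(2)[of j] by simp
    qed
    moreover have "?P (x # xs) (Suc k)" using k(1) dep[of k] False by simp
    ultimately show ?thesis by (intro ex1I[of _ "Suc k"]) auto
  qed
qed simp

section \<open>Words and the generating functions of their walks\<close>

definition words :: "'l set \<Rightarrow> nat \<Rightarrow> 'l list set" where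
  "words L n = {xs. set xs \<subseteq> L \<and> length xs = n}"

lemma words_0 [simp]: "words L 0 = {[]}"
  by (auto simp: words_def)

lemma sum_words_split:
  assumes "k \<le> n"
  shows "(\<Sum>xs\<in>words L n. f (take k xs) (drop k xs)) =
    (\<Sum>ys\<in>words L k. \<Sum>zs\<in>words L (n - k). f ys zs)"
  unfolding sum.cartesian_product
  by (rule sum.reindex_bij_witness[where i = "\<lambda>(ys, zs). ys @ zs"
        and j = "\<lambda>xs. (take k xs, drop k xs)"])
     (use assms in \<open>auto simp: words_def dest: in_set_takeD in_set_dropD\<close>)

text \<open>The weight of the endpoint is multiplicative in the letters, so it produces the powers
  of w(q) in the geometric series.\<close>

lemma sum_words_power_int:
  fixes q :: "'a::field_char_0"
  assumes "q \<noteq> 0"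
  shows "(\<Sum>xs\<in>words L n. q powi sum_list (map s xs)) = (\<Sum>x\<in>L. q powi s x) ^ n"
proof (induction n)
  case (Suc n)
  have "(\<Sum>xs\<in>words L (Suc n). q powi sum_list (map s xs)) =
      (\<Sum>(x, xs)\<in>L \<times> words L n. q powi (s x + sum_list (map s xs)))"
    by (rule sum.reindex_bij_witness[where i = "\<lambda>(x, xs). x # xs" and j = "\<lambda>xs. (hd xs, tl xs)"])
       (auto simp: words_def length_Suc_conv)
  also have "\<dots> = (\<Sum>x\<in>L. q powi s x) * (\<Sum>xs\<in>words L n. q powi sum_list (map s xs))"
    by (simp add: sum_product power_int_add assms flip: sum.cartesian_product)
  finally show ?case using Suc by simp
qed simp

text \<open>Here u marks the depth and v the final height above the minimum. Both exponents are
  nonnegative, so \<open>nat\<close> loses nothing.\<close>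

definition walk_fps :: "'l set \<Rightarrow> ('l \<Rightarrow> int) \<Rightarrow> 'a::field_char_0 \<Rightarrow> 'a \<Rightarrow> 'a fps" where
  "walk_fps L s u v = Abs_fps (\<lambda>n. \<Sum>xs\<in>words L n.
     u ^ nat (depth (map s xs)) * v ^ nat (sum_list (map s xs) + depth (map s xs)))"

text \<open>Here \<open>nat\<close> truncates on purpose, giving the negative and positive parts of
  the endpoint. The constant term is 0, as for every t F'/F.\<close>

definition endpoint_fps :: "'l set \<Rightarrow> ('l \<Rightarrow> int) \<Rightarrow> 'a::field_char_0 \<Rightarrow> 'a \<Rightarrow> 'a fps" where
  "endpoint_fps L s u v = Abs_fps (\<lambda>n. if n = 0 then 0 else \<Sum>xs\<in>words L n.
     u ^ nat (- sum_list (map s xs)) * v ^ nat (sum_list (map s xs)))"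

text \<open>This is the factor D. Heights are exponents of a formal variable, because the separation
  of D from P compares polynomial coefficients, not values.\<close>

definition descent_fps :: "'l set \<Rightarrow> ('l \<Rightarrow> int) \<Rightarrow> 'a::field_char_0 poly fps" where
  "descent_fps L s = Abs_fps (\<lambda>n. \<Sum>xs\<in>words L n.
     if ends_at_strict_min (map s xs) then monom 1 (nat (- sum_list (map s xs))) else 0)"

definition ascent_fps :: "'l set \<Rightarrow> ('l \<Rightarrow> int) \<Rightarrow> 'a::field_char_0 poly fps" where
  "ascent_fps L s = Abs_fps (\<lambda>n. \<Sum>xs\<in>words L n.
     if depth (map s xs) = 0 then monom 1 (nat (sum_list (map s xs))) else 0)"

text \<open>Every walk is cut at the first visit to its minimum.\<close>

lemma walk_fps_factorization:
  fixes u v :: "'a::field_char_0"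
  shows "walk_fps L s u v = fps_eval u (descent_fps L s) * fps_eval v (ascent_fps L s)"
proof (rule fps_ext)
  fix n
  let ?D = "\<lambda>ys. if ends_at_strict_min (map s ys) then u ^ nat (- sum_list (map s ys)) else 0"
  let ?U = "\<lambda>zs. if depth (map s zs) = 0 then v ^ nat (sum_list (map s zs)) else 0"
  let ?F = "\<lambda>xs. u ^ nat (depth (map s xs)) * v ^ nat (sum_list (map s xs) + depth (map s xs))"
  \<comment> \<open>Only the first minimum gives a nonzero summand; there the first part carries the
    whole depth and the second the whole final rise.\<close>
  have cut: "?F xs = (\<Sum>k=0..n. ?D (take k xs) * ?U (drop k xs))" if "xs \<in> words L n" for xs
  proof -
    let ?P = "\<lambda>k. k \<le> n \<and> ends_at_strict_min (map s (take k xs)) \<and> depth (map s (drop k xs)) = 0"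
    have "\<exists>!k. ?P k"
      using first_min_ex1[of "map s xs"] that by (simp add: words_def take_map drop_map)
    then obtain k where k: "?P k" "\<And>i. ?P i \<Longrightarrow> i = k" by blast
    have dep: "depth (map s xs) = - sum_list (map s (take k xs))"
      using depth_append_strict_min[of "map s (take k xs)" "map s (drop k xs)"] k(1)
      by (metis append_take_drop_id map_append)
    have sm: "sum_list (map s xs) = sum_list (map s (take k xs)) + sum_list (map s (drop k xs))"
      by (metis append_take_drop_id map_append sum_list_append)
    have "(\<Sum>i=0..n. ?D (take i xs) * ?U (drop i xs)) =
        (\<Sum>i=0..n. if i = k then ?F xs else 0)"
    proof (rule sum.cong)
      fix i assume i: "i \<in> {0..n}"
      show "?D (take i xs) * ?U (drop i xs) = (if i = k then ?F xs else 0)"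
      proof (cases "i = k")
        case True
        then show ?thesis unfolding dep sm using k(1) by simp
      next
        case False
        then have "\<not> ?P i" using k(2) by blast
        then show ?thesis using i False by auto
      qed
    qed simp
    then show ?thesis using k(1) by simp
  qed
  have "fps_nth (walk_fps L s u v) n =
      (\<Sum>k=0..n. \<Sum>xs\<in>words L n. ?D (take k xs) * ?U (drop k xs))"
    unfolding walk_fps_def fps_nth_Abs_fps
    by (subst sum.swap, rule sum.cong[OF refl], rule cut)
  also have "\<dots> = (\<Sum>k=0..n. (\<Sum>ys\<in>words L k. ?D ys) * (\<Sum>zs\<in>words L (n - k). ?U zs))"
    unfolding sum_product
    by (rule sum.cong[OF refl], rule sum_words_split[where f = "\<lambda>ys zs. ?D ys * ?U zs"]) simp
  also have "\<dots> = fps_nth (fps_eval u (descent_fps L s) * fps_eval v (ascent_fps L s)) n"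
    by (simp add: fps_mult_nth descent_fps_def ascent_fps_def poly_sum poly_monom
          if_distrib[of "\<lambda>p. poly p _"] cong: if_cong)
  finally show "fps_nth (walk_fps L s u v) n =
      fps_nth (fps_eval u (descent_fps L s) * fps_eval v (ascent_fps L s)) n" .
qed

text \<open>On the curve u v = 1 the depth cancels and only the endpoint remains.\<close>

lemma walk_fps_inverse:
  fixes q :: "'a::field_char_0"
  assumes "q \<noteq> 0"
  shows "walk_fps L s (1 / q) q = Abs_fps (\<lambda>n. (\<Sum>x\<in>L. q powi s x) ^ n)"
proof (rule fps_ext)
  fix n
  have "(1 / q) ^ nat (depth (map s xs)) * q ^ nat (sum_list (map s xs) + depth (map s xs)) =
      q powi sum_list (map s xs)" for xs
  proof -
    let ?d = "depth (map s xs)" and ?t = "sum_list (map s xs)"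
    have "(1 / q) ^ nat ?d * q ^ nat (?t + ?d) = q powi (- ?d) * q powi (?t + ?d)"
      using depth_nonneg[of "map s xs"] sum_add_depth_nonneg[of "map s xs"]
      by (simp add: power_int_def divide_inverse power_inverse)
    also have "\<dots> = q powi ?t" using assms by (simp flip: power_int_add)
    finally show ?thesis .
  qed
  then show "fps_nth (walk_fps L s (1 / q) q) n = fps_nth (Abs_fps (\<lambda>n. (\<Sum>x\<in>L. q powi s x) ^ n)) n"
    using sum_words_power_int[OF assms, of s L n] by (simp add: walk_fps_def)
qed

text \<open>One of the two exponents is always 0, so the weight is again q to the endpoint. This is
  the logarithmic derivative of the series in \<open>walk_fps_inverse\<close>.\<close>

lemma endpoint_fps_inverse:
  fixes q :: "'a::field_char_0"
  assumes "q \<noteq> 0"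
  shows "endpoint_fps L s (1 / q) q =
    Abs_fps (\<lambda>n. if n = 0 then 0 else (\<Sum>x\<in>L. q powi s x) ^ n)"
proof (rule fps_ext)
  fix n
  have "(1 / q) ^ nat (- t) * q ^ nat t = q powi t" for t
    by (cases "t \<ge> 0") (simp_all add: power_int_def divide_inverse power_inverse)
  then show "fps_nth (endpoint_fps L s (1 / q) q) n =
      fps_nth (Abs_fps (\<lambda>n. if n = 0 then 0 else (\<Sum>x\<in>L. q powi s x) ^ n)) n"
    using sum_words_power_int[OF assms, of s L n] by (simp add: endpoint_fps_def)
qed

text \<open>Negative endpoints involve only u, the others only v. Endpoint 0 is assigned to h, so g
  vanishes at 0 and the splitting is rigid.\<close>

lemma endpoint_fps_split:
  fixes L :: "'l set" and s :: "'l \<Rightarrow> int"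
  obtains g h :: "'a::field_char_0 poly fps"
  where "\<And>u v. endpoint_fps L s u v = fps_eval u g + fps_eval v h" "fps_eval 0 g = 0"
proof
  let ?g = "Abs_fps (\<lambda>n. if n = 0 then 0 else \<Sum>xs\<in>words L n.
     if sum_list (map s xs) < 0 then monom 1 (nat (- sum_list (map s xs))) else 0) :: 'a poly fps"
  let ?h = "Abs_fps (\<lambda>n. if n = 0 then 0 else \<Sum>xs\<in>words L n.
     if sum_list (map s xs) < 0 then 0 else monom 1 (nat (sum_list (map s xs)))) :: 'a poly fps"
  show "endpoint_fps L s u v = fps_eval u ?g + fps_eval v ?h" for u v
    by (rule fps_ext)
       (auto simp: endpoint_fps_def poly_sum poly_monom simp flip: sum.distrib intro!: sum.cong)
  show "fps_eval 0 ?g = 0"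
    by (rule fps_ext) (auto simp: poly_sum poly_monom intro!: sum.neutral)
qed

text \<open>The geometric series gives the identity only for u v = 1. It extends to all u and v
  because both logarithmic derivatives are a part in u without constant term plus a part in v, and
  such parts are determined by the curve.\<close>

theorem spitzer_identity:
  fixes u v :: "'a::field_char_0"
  shows "has_log_deriv (walk_fps L s u v) (endpoint_fps L s u v)"
proof -
  have D0: "fps_nth (descent_fps L s :: 'a poly fps) 0 = 1"
    and U0: "fps_nth (ascent_fps L s :: 'a poly fps) 0 = 1"
    by (simp_all add: descent_fps_def ascent_fps_def)
  obtain d :: "'a poly fps" where d: "has_log_deriv (descent_fps L s) d"
    using has_log_deriv_exists[OF D0] by blast
  obtain p :: "'a poly fps" where p: "has_log_deriv (ascent_fps L s) p"
    using has_log_deriv_exists[OF U0] by blast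
  obtain g h :: "'a poly fps" where
    gh: "\<And>u v. endpoint_fps L s u v = fps_eval u g + fps_eval v h" and g0: "fps_eval 0 g = 0"
    using endpoint_fps_split by blast
  have log: "has_log_deriv (walk_fps L s u v) (fps_eval u d + fps_eval v p)" for u v
    unfolding walk_fps_factorization
    by (intro has_log_deriv_mult has_log_deriv_eval d p)
  \<comment> \<open>A nonempty walk ending at its strict minimum has negative endpoint, so only the
    empty walk survives at u = 0; hence d vanishes there, as g does.\<close>
  have "fps_eval 0 (descent_fps L s) = (1 :: 'a fps)"
  proof (rule fps_ext)
    fix n
    have "(\<Sum>xs\<in>words L n. if ends_at_strict_min (map s xs)
        then poly (monom 1 (nat (- sum_list (map s xs)))) 0 else (0 :: 'a)) = 0" if "n > 0"
    proof (rule sum.neutral, rule ballI)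
      fix xs assume "xs \<in> words L n"
      then have "map s xs \<noteq> []" using that by (auto simp: words_def)
      then show "(if ends_at_strict_min (map s xs)
          then poly (monom 1 (nat (- sum_list (map s xs)))) 0 else (0 :: 'a)) = 0"
        using sum_neg_of_strict_min[of "map s xs"] by (simp add: poly_monom)
    qed
    then show "fps_nth (fps_eval 0 (descent_fps L s)) n = fps_nth (1 :: 'a fps) n"
      by (cases "n = 0")
         (simp_all add: descent_fps_def poly_sum if_distrib[of "\<lambda>p. poly p _"] cong: if_cong)
  qed
  then have d0: "fps_eval 0 d = 0"
    using has_log_deriv_eval[OF d, of 0] by (simp add: has_log_deriv_def)
  have "fps_eval (1 / q) d + fps_eval q p = fps_eval (1 / q) g + fps_eval q h" if "q \<noteq> 0" for q
  proof (rule has_log_deriv_unique[OF log])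
    show "has_log_deriv (walk_fps L s (1 / q) q) (fps_eval (1 / q) g + fps_eval q h)"
      unfolding gh[symmetric] walk_fps_inverse[OF that] endpoint_fps_inverse[OF that]
      by (rule has_log_deriv_geometric)
    have "fps_nth (walk_fps L s (1 / q) q) 0 = 1"
      unfolding walk_fps_inverse[OF that] by simp
    then show "walk_fps L s (1 / q) q \<noteq> 0" by auto
  qed
  then have "poly (fps_nth d n - fps_nth g n) (1 / q) = poly (fps_nth h n - fps_nth p n) q"
    if "q \<noteq> 0" for n q
    using that by (auto simp: fps_eq_iff algebra_simps)
  moreover have "poly (fps_nth d n - fps_nth g n) 0 = 0" for n
    using d0 g0 by (simp add: fps_eq_iff)
  ultimately have "fps_nth d n - fps_nth g n = 0 \<and> fps_nth h n - fps_nth p n = 0" for n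
    by (intro poly_inverse_eq_imp_0) blast+
  then have "d = g" "p = h" by (simp_all add: fps_eq_iff)
  then show ?thesis using log[of u v] by (simp add: gh)
qed


section \<open>Cycle index sums over partitions\<close>

lemma z_part_add_mset:
  assumes "i > 0"
  shows "z_part (add_mset i l) = i * Suc (count l i) * z_part l"
proof -
  let ?f = "\<lambda>l j. j ^ count l j * fact (count l j) :: nat"
  \<comment> \<open>A part of multiplicity 0 contributes the factor 1, so both products can run over
    the same index set.\<close>
  have eq: "z_part m = (\<Prod>j\<in>insert i (set_mset l). ?f m j)" if "set_mset m \<subseteq> insert i (set_mset l)" for m
    unfolding z_part_def by (rule prod.mono_neutral_left) (use that in \<open>auto simp: not_in_iff\<close>)
  have "z_part (add_mset i l) = ?f (add_mset i l) i * (\<Prod>j\<in>set_mset l - {i}. ?f (add_mset i l) j)"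
    by (subst eq) (auto simp: prod.insert_remove)
  also have "(\<Prod>j\<in>set_mset l - {i}. ?f (add_mset i l) j) = (\<Prod>j\<in>set_mset l - {i}. ?f l j)"
    by (intro prod.cong) auto
  also have "?f (add_mset i l) i * (\<Prod>j\<in>set_mset l - {i}. ?f l j) =
      i * Suc (count l i) * (?f l i * (\<Prod>j\<in>set_mset l - {i}. ?f l j))"
    by (simp add: algebra_simps)
  also have "?f l i * (\<Prod>j\<in>set_mset l - {i}. ?f l j) = z_part l"
    using eq[of l] by (simp add: subset_insertI prod.insert_remove)
  finally show ?thesis .
qed

lemma partitions_0 [simp]: "partitions 0 = {{#}}"
proof -
  have "l = {#}" if "0 \<notin># l" "sum_mset l = 0" for l :: "nat multiset"
    using that by (cases l) auto
  then show ?thesis by (auto simp: partitions_def)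
qed

lemma sum_mset_eq_sum_count: "sum_mset l = (\<Sum>i\<in>set_mset l. count l i * i)"
proof (induction l)
  case (add x l)
  show ?case
  proof (cases "x \<in># l")
    case True
    then have "(\<Sum>i\<in>set_mset l. count (add_mset x l) i * i) =
        (\<Sum>i\<in>set_mset l. count l i * i + (if i = x then i else 0))"
      by (intro sum.cong) auto
    then show ?thesis using add True by (simp add: sum.distrib insert_absorb)
  next
    case False
    then have "(\<Sum>i\<in>set_mset l. count (add_mset x l) i * i) = (\<Sum>i\<in>set_mset l. count l i * i)"
      by (intro sum.cong) auto
    then show ?thesis using add False by (simp add: not_in_iff)
  qed
qed simp

text \<open>The series is exp of the sum of p_m t^m / m. Its equation follows by double counting: n
  is the sum of the parts of l, and marking and removing a part turns l into a partition of a
  smaller number.\<close>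

lemma has_log_deriv_partition_sum:
  fixes p :: "nat \<Rightarrow> 'a::field_char_0"
  shows "has_log_deriv (Abs_fps (\<lambda>n. \<Sum>l\<in>partitions n. (\<Prod>m\<in>#l. p m) / of_nat (z_part l)))
    (Abs_fps (\<lambda>n. if n = 0 then 0 else p n))"
proof (rule has_log_derivI, unfold fps_nth_Abs_fps)
  fix n
  let ?t = "\<lambda>l. (\<Prod>m\<in>#l. p m) / of_nat (z_part l)"
  have size: "n = (\<Sum>i\<in>set_mset l. count l i * i)" if "l \<in> partitions n" for l
    using that sum_mset_eq_sum_count[of l] by (simp add: partitions_def)
  have "of_nat n * (\<Sum>l\<in>partitions n. ?t l) =
      (\<Sum>l\<in>partitions n. \<Sum>i\<in>set_mset l. of_nat (count l i * i) * ?t l)"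
    unfolding sum_distrib_left
  proof (rule sum.cong)
    fix l assume "l \<in> partitions n"
    then show "of_nat n * ?t l = (\<Sum>i\<in>set_mset l. of_nat (count l i * i) * ?t l)"
      using size[of l] by (simp only: flip: of_nat_sum sum_distrib_right)
  qed simp
  also have "\<dots> = (\<Sum>(l, i)\<in>Sigma (partitions n) set_mset. of_nat (count l i * i) * ?t l)"
    by (rule sum.Sigma) (auto simp: finite_partitions)
  \<comment> \<open>The marked part i is removed; its weight, i times its multiplicity, cancels
    against the factor from \<open>z_part_add_mset\<close>.\<close>
  also have "\<dots> = (\<Sum>(i, l)\<in>Sigma {1..n} (\<lambda>i. partitions (n - i)). p i * ?t l)"
  proof (rule sum.reindex_bij_witness[where i = "\<lambda>(i, l). (add_mset i l, i)"
        and j = "\<lambda>(l, i). (i, l - {#i#})"], goal_cases)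
    case (2 x)
    then obtain l i where x: "x = (l, i)" "0 \<notin># l" "sum_mset l = n" "i \<in># l"
      by (auto simp: partitions_def)
    then obtain l' where "l = add_mset i l'" by (metis mset_add)
    then show ?case using x by (auto simp: partitions_def intro!: Suc_leI)
  next
    case (5 x)
    then obtain l i where x: "x = (l, i)" "0 \<notin># l" "sum_mset l = n" "i \<in># l"
      by (auto simp: partitions_def)
    then obtain l' where l: "l = add_mset i l'" by (metis mset_add)
    have "i > 0" using x by (cases i) auto
    moreover have "of_nat (c * i) * (y * w / of_nat (i * c * z)) = y * (w / of_nat z)"
      if "c > 0" for c z :: nat and y w :: 'a
      using that \<open>i > 0\<close> by (simp add: field_simps)
    ultimately show ?case
      using x l by (simp add: z_part_add_mset del: of_nat_mult of_nat_Suc mult_Suc mult_Suc_right)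
  qed (auto simp: partitions_def)
  also have "\<dots> = (\<Sum>i\<in>{1..n}. p i * (\<Sum>l\<in>partitions (n - i). ?t l))"
    unfolding sum_distrib_left by (rule sum.Sigma[symmetric]) (auto simp: finite_partitions)
  also have "\<dots> = (\<Sum>i=0..n. (if i = 0 then 0 else p i) * (\<Sum>l\<in>partitions (n - i). ?t l))"
    by (rule sum.mono_neutral_cong_left) auto
  finally show "of_nat n * (\<Sum>l\<in>partitions n. ?t l) =
      (\<Sum>i=0..n. (if i = 0 then 0 else p i) * (\<Sum>l\<in>partitions (n - i). ?t l))" .
qed


section \<open>Rank functions\<close>

text \<open>The set consists of the r smallest elements of A; prefix counts are all that the
  Schubert condition needs.\<close>

lemma first_elements_exist:
  fixes A :: "nat set"
  assumes "finite A" "r \<le> card A"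
  shows "\<exists>I\<subseteq>A. card I = r \<and> (\<forall>k. card (I \<inter> {..k}) = min (card (A \<inter> {..k})) r)"
  using assms
proof (induction A rule: finite_linorder_max_induct)
  case (insert m A)
  have notin: "m \<notin> A" using insert.hyps(2) by auto
  show ?case
  proof (cases "r \<le> card A")
    case True
    then obtain I where I: "I \<subseteq> A" "card I = r" "\<And>k. card (I \<inter> {..k}) = min (card (A \<inter> {..k})) r"
      using insert.IH by blast
    have "min (card (insert m A \<inter> {..k})) r = min (card (A \<inter> {..k})) r" for k
    proof (cases "k < m")
      case False
      then have "A \<inter> {..k} = A" using insert.hyps(2) by fastforce
      then show ?thesis using True False insert.hyps(1) notin by simp
    qed simp
    then show ?thesis using I by (intro exI[of _ I]) auto
  next
    case False
    then have r: "r = card (insert m A)" using insert.prems insert.hyps(1) notin by simp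
    have "card (insert m A \<inter> {..k}) \<le> r" for k
      unfolding r using insert.hyps(1) by (intro card_mono) auto
    then show ?thesis using r by (intro exI[of _ "insert m A"]) (auto simp: min_def)
  qed
qed auto

lemma rk_eqI:
  assumes "finite A" "I \<subseteq> A" "indep M I" "card I = r"
    and "\<And>J. J \<subseteq> A \<Longrightarrow> indep M J \<Longrightarrow> card J \<le> r"
  shows "rk M A = r"
proof -
  have "{card J | J. J \<subseteq> A \<and> indep M J} \<subseteq> card ` Pow A" by blast
  then have "finite {card J | J. J \<subseteq> A \<and> indep M J}"
    by (rule finite_subset) (use assms(1) in simp)
  moreover have "r \<in> {card J | J. J \<subseteq> A \<and> indep M J}" using assms(2-4) by blast
  ultimately show ?thesis unfolding rk_def using assms(5) by (intro Max_eqI) blast+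
qed

lemma rk_uniform:
  assumes A: "A \<subseteq> {1..N}" and "r \<le> N"
  shows "rk (uniform_matroid r N) A = min (card A) r"
proof -
  have fin: "finite A" using A finite_subset by blast
  obtain I where I: "I \<subseteq> A" "card I = min (card A) r"
    using obtain_subset_with_card_n[of "min (card A) r" A] by auto
  obtain B where "I \<subseteq> B" "B \<subseteq> {1..N}" "card B = r"
    using exists_subset_between[of I r "{1..N}"] I A \<open>r \<le> N\<close> by auto
  then have "indep (uniform_matroid r N) I" by (auto simp: indep_def uniform_matroid_def)
  moreover have "card J \<le> min (card A) r" if J: "J \<subseteq> A" "indep (uniform_matroid r N) J" for J
  proof -
    obtain B where "J \<subseteq> B" "B \<subseteq> {1..N}" "card B = r"
      using J(2) by (auto simp: indep_def uniform_matroid_def)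
    moreover from this have "finite B" using finite_subset by blast
    ultimately have "card J \<le> r" using card_mono by metis
    moreover have "card J \<le> card A" using J(1) fin by (rule card_mono[rotated])
    ultimately show ?thesis by simp
  qed
  ultimately show ?thesis using fin I by (intro rk_eqI)
qed

lemma bases_schubert:
  assumes "S \<subseteq> {1..N}"
  shows "T \<in> bases (schubert_matroid N S) \<longleftrightarrow>
    T \<subseteq> {1..N} \<and> card T = card S \<and> (\<forall>k. card (S \<inter> {..k}) \<le> card (T \<inter> {..k}))"
proof (cases "T \<subseteq> {1..N} \<and> card T = card S")
  case True
  then have "finite T" "finite S" using assms finite_subset by blast+
  then show ?thesis
    using True sorted_list_of_set_le_iff_card[of S T] by (simp add: schubert_matroid_def)
qed (auto simp: schubert_matroid_def)

text \<open>The number d is the largest deficit of A against S over all prefixes. The smallest |S| -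
  d elements of A, completed by the d smallest elements outside them, form a basis; the prefix at
  \<open>k0\<close> gives the upper bound.\<close>

lemma rk_schubert:
  assumes S: "S \<subseteq> {1..N}" and A: "A \<subseteq> {1..N}"
    and le: "\<And>k. card (S \<inter> {..k}) \<le> card (A \<inter> {..k}) + d"
    and eq: "card (S \<inter> {..k0}) = card (A \<inter> {..k0}) + d"
  shows "rk (schubert_matroid N S) A = card S - d"
proof -
  have fin: "finite A" "finite S" using A S finite_subset by blast+
  have d_le: "d \<le> card S" using eq card_mono[of S "S \<inter> {..k0}"] fin by auto
  have cS: "card S \<le> N" using S card_mono[of "{1..N}" S] by simp
  have "A \<inter> {..N} = A" "S \<inter> {..N} = S" using A S by auto
  then have cA: "card S - d \<le> card A" using le[of N] by simp
  obtain I where I: "I \<subseteq> A" "card I = card S - d"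
      "\<forall>k. card (I \<inter> {..k}) = min (card (A \<inter> {..k})) (card S - d)"
    using first_elements_exist[OF fin(1) cA] by blast
  have finI: "finite I" using I(1) fin finite_subset by blast
  let ?C = "{1..N} - I"
  have "card ?C = N - (card S - d)"
    using I A by (subst card_Diff_subset) (auto simp: finI)
  then have cC: "d \<le> card ?C" using cS d_le by linarith
  then obtain J where J: "J \<subseteq> ?C" "card J = d"
      "\<forall>k. card (J \<inter> {..k}) = min (card (?C \<inter> {..k})) d"
    using first_elements_exist[OF _ cC] by blast
  have finJ: "finite J" using J(1) finite_subset by blast
  have disj: "I \<inter> J = {}" using J(1) by blast
  have "I \<union> J \<in> bases (schubert_matroid N S)"
    unfolding bases_schubert[OF S]
  proof (intro conjI allI)
    show "I \<union> J \<subseteq> {1..N}" using I J A by blast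
    show "card (I \<union> J) = card S" using I J d_le disj finI finJ by (simp add: card_Un_disjoint)
    fix k
    have c1: "card ((I \<union> J) \<inter> {..k}) = card (I \<inter> {..k}) + card (J \<inter> {..k})"
      using disj finI finJ by (simp add: Int_Un_distrib2 card_Un_disjoint disjoint_iff)
    have c2: "card ({1..N} \<inter> {..k}) = card (I \<inter> {..k}) + card (?C \<inter> {..k})"
    proof -
      have "{1..N} \<inter> {..k} = (I \<inter> {..k}) \<union> (?C \<inter> {..k})" using I A by auto
      then show ?thesis using finI by (simp add: card_Un_disjoint disjoint_iff)
    qed
    \<comment> \<open>If at most d elements up to k lie outside I, then I and J cover the whole
      prefix; otherwise all of J is counted and the total is the minimum of |A \<inter> {..k}| + d
      and |S|.\<close>
    have "card (S \<inter> {..k}) \<le> card ({1..N} \<inter> {..k})" using S by (intro card_mono) auto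
    moreover have "card (S \<inter> {..k}) \<le> card S" using fin by (intro card_mono) auto
    ultimately show "card (S \<inter> {..k}) \<le> card ((I \<union> J) \<inter> {..k})"
      using c1 c2 le[of k] I(3)[rule_format, of k] J(3)[rule_format, of k] d_le
      by linarith
  qed
  then have "indep (schubert_matroid N S) I" unfolding indep_def by blast
  moreover have "card K \<le> card S - d" if K: "K \<subseteq> A" "indep (schubert_matroid N S) K" for K
  proof -
    obtain T where T: "K \<subseteq> T" "T \<subseteq> {1..N}" "card T = card S" "card (S \<inter> {..k0}) \<le> card (T \<inter> {..k0})"
      using K(2) bases_schubert[OF S] unfolding indep_def by blast
    have finT: "finite T" using T(2) finite_subset by blast
    \<comment> \<open>Up to \<open>k0\<close> the set K is bounded by A; beyond \<open>k0\<close> by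
      the basis T, which has already spent at least |S \<inter> {..k0}| elements.\<close>
    have "K \<subseteq> (A \<inter> {..k0}) \<union> (T - {..k0})" using K(1) T(1) by auto
    then have "card K \<le> card ((A \<inter> {..k0}) \<union> (T - {..k0}))"
      using fin finT by (intro card_mono) auto
    also have "\<dots> \<le> card (A \<inter> {..k0}) + card (T - {..k0})" by (rule card_Un_le)
    also have "card (T - {..k0}) = card T - card (T \<inter> {..k0})"
      using card_Diff_subset_Int[of T "{..k0}"] finT by simp
    finally have "card K \<le> card (A \<inter> {..k0}) + (card T - card (T \<inter> {..k0}))" by simp
    moreover have "card (T \<inter> {..k0}) \<le> card T" using finT by (intro card_mono) auto
    ultimately show ?thesis using T(3,4) eq by linarith
  qed
  ultimately show ?thesis using fin I by (intro rk_eqI)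
qed


section \<open>Subsets as walks\<close>

text \<open>The letter at index \<open>i\<close> is the trace of the subset on the block \<open>{i L + 1..(i + 1) L}\<close>.\<close>

definition block_word :: "nat \<Rightarrow> nat \<Rightarrow> nat set \<Rightarrow> nat set list" where
  "block_word L n A = map (\<lambda>i. {y\<in>{1..L}. i * L + y \<in> A}) [0..<n]"

lemma block_position_iff:
  fixes L i j y z :: nat
  assumes "y \<in> {1..L}" "z \<in> {1..L}"
  shows "i * L + y = j * L + z \<longleftrightarrow> i = j \<and> y = z"
proof
  assume eq: "i * L + y = j * L + z"
  \<comment> \<open>Positions in a block start at 1, so y - 1 is the remainder.\<close>
  have "(k * L + m) div L = k" if "m < L" for k m using that by simp
  moreover have "y - 1 < L" "z - 1 < L" using assms by auto
  ultimately have "(i * L + (y - 1)) div L = i" "(j * L + (z - 1)) div L = j" by blast+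
  moreover have "i * L + (y - 1) = j * L + (z - 1)" using eq assms by simp
  ultimately have "i = j" by metis
  then show "i = j \<and> y = z" using eq by simp
qed simp

lemma block_position_exists:
  fixes x L n :: nat
  assumes "x \<in> {1..n * L}"
  obtains i y where "i < n" "y \<in> {1..L}" "x = i * L + y"
proof
  have "L > 0" using assms by (cases L) auto
  have "x - 1 < n * L" using assms by auto
  then show "(x - 1) div L < n" by (simp add: less_mult_imp_div_less)
  show "Suc ((x - 1) mod L) \<in> {1..L}" using \<open>L > 0\<close> by (simp add: Suc_leI)
  show "x = (x - 1) div L * L + Suc ((x - 1) mod L)" using assms by simp
qed

text \<open>Gluing the letters back into their disjoint blocks inverts \<open>block_word\<close>; a
  Tutte sum thereby becomes a coefficient of a walk series.\<close>

lemma sum_subsets_eq_sum_words: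
  "(\<Sum>A\<in>Pow {1..n * L}. f (block_word L n A)) = (\<Sum>xs\<in>words (Pow {1..L}) n. f xs)"
proof (rule sum.reindex_bij_witness[where j = "block_word L n"
      and i = "\<lambda>xs. {i * L + y | i y. i < n \<and> y \<in> xs ! i}"], goal_cases)
  case (1 A)
  show ?case
  proof (rule set_eqI)
    fix x
    have "x \<in> A" if "i < n" "y \<in> block_word L n A ! i" "x = i * L + y" for i y
      using that by (simp add: block_word_def)
    moreover have "\<exists>i y. x = i * L + y \<and> i < n \<and> y \<in> block_word L n A ! i" if "x \<in> A"
    proof -
      obtain i y where "i < n" "y \<in> {1..L}" "x = i * L + y"
        using block_position_exists[of x n L] \<open>x \<in> A\<close> 1 by blast
      then show ?thesis using that
        by (intro exI[of _ i] exI[of _ y]) (simp add: block_word_def)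
    qed
    ultimately show "x \<in> {i * L + y | i y. i < n \<and> y \<in> block_word L n A ! i} \<longleftrightarrow> x \<in> A" by blast
  qed
next
  case (2 A)
  then show ?case by (auto simp: words_def block_word_def)
next
  case (3 xs)
  then have len: "length xs = n" and sub: "\<And>i. i < n \<Longrightarrow> xs ! i \<subseteq> {1..L}"
    by (auto simp: words_def subset_iff) (meson nth_mem)+
  show ?case
  proof (rule nth_equalityI)
    fix j assume "j < length (block_word L n {i * L + y | i y. i < n \<and> y \<in> xs ! i})"
    then have j: "j < n" by (simp add: block_word_def)
    have "z \<in> {1..L} \<and> (\<exists>i y. j * L + z = i * L + y \<and> i < n \<and> y \<in> xs ! i) \<longleftrightarrow> z \<in> xs ! j" for z
      using sub j block_position_iff by (metis subsetD)
    then show "block_word L n {i * L + y | i y. i < n \<and> y \<in> xs ! i} ! j = xs ! j"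
      using j by (auto simp: block_word_def)
  qed (simp add: len block_word_def)
next
  case (4 xs)
  then have sub: "xs ! i \<subseteq> {1..L}" if "i < n" for i
    using that by (auto simp: words_def subset_iff) (meson nth_mem)+
  have "i * L + y \<in> {1..n * L}" if "i < n" "y \<in> xs ! i" for i y
  proof -
    have y: "y \<in> {1..L}" using sub that by blast
    have "Suc i * L \<le> n * L" using that by (intro mult_right_mono) auto
    then show ?thesis using y by simp
  qed
  then show ?case by auto
qed simp

text \<open>Partial sums of the walk become prefix counts, the form used by
  \<open>rk_schubert\<close>.\<close>

lemma sum_block_word:
  assumes A: "A \<subseteq> {1..n * L}" and "j \<le> n"
  shows "sum_list (take j (map (\<lambda>B. int (card B) - int b) (block_word L n A))) =
    int (card (A \<inter> {..j * L})) - int (j * b)"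
  using \<open>j \<le> n\<close>
proof (induction j)
  case 0
  have "A \<inter> {..0} = {}" using A by auto
  then show ?case by simp
next
  case (Suc j)
  let ?B = "{y\<in>{1..L}. j * L + y \<in> A}"
  have fin: "finite A" using A finite_subset by blast
  have "A \<inter> {..Suc j * L} = (A \<inter> {..j * L}) \<union> (\<lambda>y. j * L + y) ` ?B"
  proof (rule set_eqI)
    fix x
    show "x \<in> A \<inter> {..Suc j * L} \<longleftrightarrow> x \<in> (A \<inter> {..j * L}) \<union> (\<lambda>y. j * L + y) ` ?B"
    proof (cases "x \<le> j * L")
      case False
      then have "x = j * L + (x - j * L)" by simp
      then show ?thesis using False by (auto intro!: image_eqI[of x _ "x - j * L"])
    qed auto
  qed
  moreover have "card ((A \<inter> {..j * L}) \<union> (\<lambda>y. j * L + y) ` ?B) =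
      card (A \<inter> {..j * L}) + card ((\<lambda>y. j * L + y) ` ?B)"
    using fin by (intro card_Un_disjoint) auto
  moreover have "card ((\<lambda>y. j * L + y) ` ?B) = card ?B" by (intro card_image) (auto simp: inj_on_def)
  ultimately have "card (A \<inter> {..Suc j * L}) = card (A \<inter> {..j * L}) + card ?B" by simp
  then show ?case using Suc by (simp add: take_Suc_conv_app_nth block_word_def)
qed


section \<open>Tutte polynomials of uniform and Catalan matroids\<close>

text \<open>Spitzer's identity is stated over a field of characteristic 0, hence the passage to
  rational values.\<close>

definition tutte_eval :: "rat \<Rightarrow> rat \<Rightarrow> 'a pre_matroid \<Rightarrow> rat" where
  "tutte_eval x y M = poly (poly (tutte_poly M) [:y:]) x"

lemma tutte_eval_altdef:
  "tutte_eval x y M = (\<Sum>A\<in>Pow (ground M).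
     (x - 1) ^ (rk M (ground M) - rk M A) * (y - 1) ^ (card A - rk M A))"
  by (simp add: tutte_eval_def tutte_poly_def var_x_def var_y_def poly_sum)

abbreviation block_step :: "nat \<Rightarrow> nat set \<Rightarrow> int" where
  "block_step b B \<equiv> int (card B) - int b"

text \<open>The endpoint is |A| - m b, and the rank is the minimum of |A| and m b, so corank and
  nullity are its negative and positive parts.\<close>

lemma tutte_eval_U:
  assumes "m > 0"
  shows "tutte_eval x y (U_matroid a b m) =
    fps_nth (endpoint_fps (Pow {1..a + b}) (block_step b) (x - 1) (y - 1)) m"
proof -
  let ?N = "m * (a + b)" and ?M = "U_matroid a b m"
  let ?F = "\<lambda>xs. (x - 1) ^ nat (- sum_list (map (block_step b) xs)) *
    (y - 1) ^ nat (sum_list (map (block_step b) xs))"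
  have rk: "rk ?M A = min (card A) (m * b)" if "A \<subseteq> {1..?N}" for A
    using rk_uniform[OF that, of "m * b"] by (simp add: U_matroid_def)
  have ground: "ground ?M = {1..?N}" by (simp add: U_matroid_def uniform_matroid_def)
  have "tutte_eval x y ?M = (\<Sum>A\<in>Pow {1..?N}. ?F (block_word (a + b) m A))"
    unfolding tutte_eval_altdef ground
  proof (rule sum.cong)
    fix A assume "A \<in> Pow {1..?N}"
    then have A: "A \<subseteq> {1..?N}" by simp
    have "A \<inter> {..?N} = A" using A by auto
    then have "sum_list (map (block_step b) (block_word (a + b) m A)) = int (card A) - int (m * b)"
      using sum_block_word[OF A order.refl, of b] by (simp add: block_word_def)
    moreover have "rk ?M {1..?N} = m * b" using rk by simp
    moreover have "nat (- (int (card A) - int (m * b))) = m * b - min (card A) (m * b)"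
      "nat (int (card A) - int (m * b)) = card A - min (card A) (m * b)" by linarith+
    ultimately show "(x - 1) ^ (rk ?M {1..?N} - rk ?M A) * (y - 1) ^ (card A - rk ?M A) =
        ?F (block_word (a + b) m A)"
      using rk[OF A] by metis
  qed simp
  also have "\<dots> = (\<Sum>xs\<in>words (Pow {1..a + b}) m. ?F xs)" by (rule sum_subsets_eq_sum_words)
  finally show ?thesis using \<open>m > 0\<close> by (simp add: endpoint_fps_def)
qed

section \<open>Ranks in the Catalan matroid\<close>

definition catalan_set :: "nat \<Rightarrow> nat \<Rightarrow> nat \<Rightarrow> nat set" where
  "catalan_set a b n =
     set_of_indicator (concat (replicate n (replicate a False @ replicate b True)))"

lemma catalan_set_altdef: "catalan_set a b n = {Suc i | i. i < n * (a + b) \<and> a \<le> i mod (a + b)}"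
proof -
  let ?w = "\<lambda>n. concat (replicate n (replicate a False @ replicate b True))"
  have len: "length (?w n) = n * (a + b)" for n by (induction n) auto
  have "?w n ! i \<longleftrightarrow> a \<le> i mod (a + b)" if "i < n * (a + b)" for i
    using that
  proof (induction n arbitrary: i)
    case (Suc n)
    let ?b = "replicate a False @ replicate b True"
    have w: "?w (Suc n) = ?b @ ?w n" by simp
    show ?case
    proof (cases "i < a + b")
      case True
      then show ?thesis unfolding w nth_append[of ?b] by (auto simp: nth_append)
    next
      case False
      then have "?w (Suc n) ! i = ?w n ! (i - (a + b))" unfolding w nth_append[of ?b] by simp
      also have "\<dots> \<longleftrightarrow> a \<le> (i - (a + b)) mod (a + b)" using Suc False by (intro Suc.IH) auto
      also have "(i - (a + b)) mod (a + b) = i mod (a + b)"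
        using False by (simp add: le_mod_geq)
      finally show ?thesis .
    qed
  qed simp
  then show ?thesis unfolding catalan_set_def set_of_indicator_def len by blast
qed

lemma catalan_set_subset: "catalan_set a b n \<subseteq> {1..n * (a + b)}"
  by (auto simp: catalan_set_altdef)

text \<open>Each full block contributes b; the truncated subtraction counts the ones reached in the
  last, incomplete block.\<close>

lemma card_catalan_set_prefix:
  assumes "k \<le> n * (a + b)"
  shows "card (catalan_set a b n \<inter> {..k}) = k div (a + b) * b + (k mod (a + b) - a)"
  using assms
proof (induction k)
  case 0
  have "catalan_set a b n \<inter> {..0} = {}" by (auto simp: catalan_set_altdef)
  then show ?case by simp
next
  case (Suc k)
  have pos: "a + b > 0" using Suc.prems by (cases "a + b") auto
  have "catalan_set a b n \<inter> {..Suc k} =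
      (if a \<le> k mod (a + b) then insert (Suc k) (catalan_set a b n \<inter> {..k})
       else catalan_set a b n \<inter> {..k})"
    using Suc.prems by (auto simp: catalan_set_altdef le_Suc_eq) (metis Suc_leI le_neq_implies_less)
  then have "card (catalan_set a b n \<inter> {..Suc k}) =
      card (catalan_set a b n \<inter> {..k}) + (if a \<le> k mod (a + b) then 1 else 0)"
    by simp
  also have "\<dots> = Suc k div (a + b) * b + (Suc k mod (a + b) - a)"
    using Suc pos mod_less_divisor[OF pos, of k] by (auto simp: div_Suc mod_Suc)
  finally show ?case .
qed

text \<open>At block ends the deficit of A against the Catalan set is minus the height of the walk.
  The remaining point is that no deficit inside a block exceeds those at its two ends.\<close>

lemma rk_catalan:
  assumes A: "A \<subseteq> {1..n * (a + b)}"
  shows "int (rk (catalan_matroid a b n) A) =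
    int (n * b) - depth (map (block_step b) (block_word (a + b) n A))"
proof -
  let ?L = "a + b" and ?S = "catalan_set a b n"
  let ?xs = "map (block_step b) (block_word ?L n A)"
  define d where "d = nat (depth ?xs)"
  have d: "depth ?xs = int d" using depth_nonneg by (simp add: d_def)
  have fin: "finite A" using A finite_subset by blast
  have len: "length ?xs = n" by (simp add: block_word_def)
  have S_block: "card (?S \<inter> {..j * ?L}) = j * b" if "j \<le> n" for j
  proof (cases "?L = 0")
    case False
    then show ?thesis using that card_catalan_set_prefix[of "j * ?L" n a b] by (simp del: add_is_0)
  qed (auto simp: catalan_set_altdef)
  have cS: "card ?S = n * b"
  proof -
    have "?S \<inter> {..n * ?L} = ?S" using catalan_set_subset[of a b n] by auto
    then show ?thesis using S_block[of n] by simp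
  qed
  have le_block: "j * b \<le> card (A \<inter> {..j * ?L}) + d" if "j \<le> n" for j
    using depth_ge[of j ?xs] sum_block_word[OF A that, of b] d by linarith
  obtain j0 where j0: "j0 \<le> n" "depth ?xs = - sum_list (take j0 ?xs)"
    using depth_attained[of ?xs] len by auto
  have eq: "card (?S \<inter> {..j0 * ?L}) = card (A \<inter> {..j0 * ?L}) + d"
    using j0(2) sum_block_word[OF A j0(1), of b] d S_block[OF j0(1)] by linarith
  have le: "card (?S \<inter> {..k}) \<le> card (A \<inter> {..k}) + d" if k: "k \<le> n * ?L" for k
  proof (cases "k mod ?L \<le> a")
    \<comment> \<open>Among the zeros S has gained nothing since the start of the block, so the
      deficit is at most the one there.\<close>
    case True
    have "m * l div l \<le> m" for m l :: nat by (cases "l = 0") auto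
    then have "k div ?L \<le> n" using div_le_mono[OF k, of ?L] order.trans by blast
    then have "k div ?L * b \<le> card (A \<inter> {..k div ?L * ?L}) + d" by (rule le_block)
    moreover have "card (A \<inter> {..k div ?L * ?L}) \<le> card (A \<inter> {..k})"
      using fin div_times_less_eq_dividend[of k ?L] by (intro card_mono) (auto intro: order.trans)
    ultimately show ?thesis using True card_catalan_set_prefix[OF k] by simp
  next
    case False
    \<comment> \<open>Among the ones S gains an element at every position and A at most one, so the
      deficit at the end of the block is at least that at k.\<close>
    let ?j = "Suc (k div ?L)"
    have pos: "?L > 0"
      using False k by (cases "?L = 0") auto
    have r: "k mod ?L < ?L" using pos by simp
    have kj: "k = k div ?L * ?L + k mod ?L" by (rule div_mult_mod_eq[symmetric])
    have "k div ?L < n"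
    proof (rule ccontr)
      assume "\<not> k div ?L < n"
      then have "n * ?L \<le> k div ?L * ?L" by (intro mult_right_mono) auto
      then have "k mod ?L = 0" using k kj by linarith
      then show False using False by simp
    qed
    then have "?j * b \<le> card (A \<inter> {..?j * ?L}) + d" by (intro le_block) simp
    moreover have "card (A \<inter> {..?j * ?L}) \<le> card (A \<inter> {..k}) + (?L - k mod ?L)"
    proof -
      have "card (A \<inter> {..?j * ?L}) \<le> card ((A \<inter> {..k}) \<union> {k<..?j * ?L})"
        using fin by (intro card_mono) auto
      also have "\<dots> \<le> card (A \<inter> {..k}) + card {k<..?j * ?L}" by (rule card_Un_le)
      also have "card {k<..?j * ?L} = ?L - k mod ?L" using kj by simp
      finally show ?thesis .
    qed
    moreover have "card (?S \<inter> {..k}) = k div ?L * b + (k mod ?L - a)"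
      by (rule card_catalan_set_prefix[OF k])
    ultimately show ?thesis using False r by simp
  qed
  have le': "card (?S \<inter> {..k}) \<le> card (A \<inter> {..k}) + d" for k
  proof (cases "k \<le> n * ?L")
    case False
    then have "?S \<inter> {..k} = ?S \<inter> {..n * ?L}" "A \<inter> {..k} = A \<inter> {..n * ?L}"
      using catalan_set_subset[of a b n] A by auto
    then show ?thesis using le[of "n * ?L"] by simp
  qed (rule le)
  have "rk (schubert_matroid (n * ?L) ?S) A = card ?S - d"
    by (rule rk_schubert[OF catalan_set_subset A le' eq])
  \<comment> \<open>This keeps the natural subtraction in the rank from truncating.\<close>
  moreover have "d \<le> n * b"
    using eq S_block[OF j0(1)] mult_le_mono1[OF j0(1), of b] by simp
  ultimately show ?thesis using d cS by (simp add: catalan_matroid_def catalan_set_def)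
qed

lemma tutte_eval_catalan:
  "tutte_eval x y (catalan_matroid a b n) =
    fps_nth (walk_fps (Pow {1..a + b}) (block_step b) (x - 1) (y - 1)) n"
proof -
  let ?N = "n * (a + b)" and ?M = "catalan_matroid a b n"
  let ?F = "\<lambda>xs. (x - 1) ^ nat (depth (map (block_step b) xs)) *
    (y - 1) ^ nat (sum_list (map (block_step b) xs) + depth (map (block_step b) xs))"
  have ground: "ground ?M = {1..?N}" by (simp add: catalan_matroid_def schubert_matroid_def)
  \<comment> \<open>The whole ground set gives the walk with all steps equal to a, which has depth
    0.\<close>
  have full: "rk ?M {1..?N} = n * b"
  proof -
    have "block_word (a + b) n {1..?N} = map (\<lambda>i. {1..a + b}) [0..<n]"
    proof -
      have "i * (a + b) + y \<le> ?N" if "i < n" "y \<le> a + b" for i y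
        using mult_le_mono1[of "Suc i" n "a + b"] that by simp
      then show ?thesis by (auto simp: block_word_def)
    qed
    moreover have "depth (map f xs) = 0" if "\<And>x. f x \<ge> 0" for f :: "nat \<Rightarrow> int" and xs
      using that by (induction xs) auto
    ultimately show ?thesis using rk_catalan[of "{1..?N}" n a b]
      by (simp add: comp_def del: of_nat_mult)
  qed
  have "tutte_eval x y ?M = (\<Sum>A\<in>Pow {1..?N}. ?F (block_word (a + b) n A))"
    unfolding tutte_eval_altdef ground
  proof (rule sum.cong)
    fix A assume "A \<in> Pow {1..?N}"
    then have A: "A \<subseteq> {1..?N}" by simp
    let ?t = "sum_list (map (block_step b) (block_word (a + b) n A))"
    let ?d = "depth (map (block_step b) (block_word (a + b) n A))"
    have "A \<inter> {..?N} = A" using A by auto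
    then have t: "?t = int (card A) - int (n * b)"
      using sum_block_word[OF A order.refl, of b] by (simp add: block_word_def)
    have "nat ?d = rk ?M {1..?N} - rk ?M A" "nat (?t + ?d) = card A - rk ?M A"
      using rk_catalan[OF A] full t by linarith+
    then show "(x - 1) ^ (rk ?M {1..?N} - rk ?M A) * (y - 1) ^ (card A - rk ?M A) =
        ?F (block_word (a + b) n A)"
      by simp
  qed simp
  also have "\<dots> = (\<Sum>xs\<in>words (Pow {1..a + b}) n. ?F xs)" by (rule sum_subsets_eq_sum_words)
  finally show ?thesis by (simp add: walk_fps_def)
qed

text \<open>If p - q were nonzero, then as a polynomial in the outer variable over an integral
  domain it would have all the constants as roots, which are infinitely many.\<close>

lemma bivariate_poly_eqI:
  fixes p q :: "'a::{idom, ring_char_0} poly poly"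
  assumes "\<And>x y. poly (poly p [:y:]) x = poly (poly q [:y:]) x"
  shows "p = q"
proof (rule ccontr)
  assume "p \<noteq> q"
  have "poly p [:y:] = poly q [:y:]" for y
    using assms poly_eq_poly_eq_iff by blast
  then have "range (\<lambda>y. [:y:]) \<subseteq> {z. poly (p - q) z = 0}" by auto
  moreover have "finite {z. poly (p - q) z = 0}" using \<open>p \<noteq> q\<close> by (intro poly_roots_finite) simp
  ultimately have "finite (range (\<lambda>y :: 'a. [:y:]))" by (rule finite_subset)
  then show False using finite_imageD[of "\<lambda>y :: 'a. [:y:]" UNIV] infinite_UNIV_char_0
    by (auto simp: inj_on_def)
qed

theorem corollary4p5:
  fixes a b n :: nat
  assumes "a > 0" and "b > 0" and "n > 0"
  shows "tutte_poly (catalan_matroid a b n) =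
    (\<Sum>l\<in>partitions n.
       smult [:1 / of_nat (z_part l):] (\<Prod>m\<in>#l. tutte_poly (U_matroid a b m)))"
proof (rule bivariate_poly_eqI)
  fix x y :: rat
  let ?p = "\<lambda>m. tutte_eval x y (U_matroid a b m)"
  let ?F = "walk_fps (Pow {1..a + b}) (block_step b) (x - 1) (y - 1)"
  let ?G = "endpoint_fps (Pow {1..a + b}) (block_step b) (x - 1) (y - 1)"
  let ?H = "Abs_fps (\<lambda>n. \<Sum>l\<in>partitions n. (\<Prod>m\<in>#l. ?p m) / of_nat (z_part l))"
  \<comment> \<open>The endpoint series supplies the power sums of the cycle index; at n = 0 both
    sides are 0 by convention.\<close>
  have G: "?G = Abs_fps (\<lambda>n. if n = 0 then 0 else ?p n)"
    by (rule fps_ext) (simp add: tutte_eval_U, simp add: endpoint_fps_def)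
  have "?F = ?H"
  proof (rule has_log_deriv_eqI)
    show "has_log_deriv ?F ?G" by (rule spitzer_identity)
    show "has_log_deriv ?H ?G" unfolding G by (rule has_log_deriv_partition_sum)
  qed (simp_all add: endpoint_fps_def walk_fps_def z_part_def)
  then have "tutte_eval x y (catalan_matroid a b n) = fps_nth ?H n"
    by (simp only: tutte_eval_catalan)
  then show "poly (poly (tutte_poly (catalan_matroid a b n)) [:y:]) x =
      poly (poly (\<Sum>l\<in>partitions n. smult [:1 / of_nat (z_part l):]
        (\<Prod>m\<in>#l. tutte_poly (U_matroid a b m))) [:y:]) x"
    by (simp add: tutte_eval_def poly_sum poly_prod_mset)
qed

end
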